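(* Consider the overlay communication problem (P) described in the context, with demand set $H$, and let $\boldsymbol{z}=(z^h_{ij})$ be a given routing solution. A unicast flow activated by $z^h_{ij}=1$ is a flow in the underlay carrying the content of $h\in H$ from agent $i$ to agent $j$ (along the path $\underline{p}_{i,j}$). For each underlay link $\underline{e}\in\underline{E}$ define $$t_{\underline{e}}:=\sum_{(i,j):\,\underline{e}\in\underline{p}_{i,j}}\ \sum_{h\in H} z^h_{ij},$$ the number of activated unicast flows traversing $\underline{e}$. If $l_{i,j}=0$ for all $(i,j)\in E$ and $\kappa_h=\kappa$ for all $h\in H$, then the optimal objective value of (P) under the given $\boldsymbol{z}$ (that is, minimizing over the remaining variables with $\boldsymbol{z}$ fixed) is $$\tau=\max_{\underline{e}\in\underline{E}}\frac{\kappa\, t_{\underline{e}}}{C_{\underline{e}}},$$ and it is achieved by equally sharing the bandwidth at every underlay link among the activated unicast flows traversing it.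
   Context: **Network.** $V$ is a set of $m$ agents (overlay nodes). The overlay is fully connected: $E$ contains the links between all pairs of distinct nodes of $V$. The underlay is a connected graph $\underline{G}=(\underline{V},\underline{E})$ with $V\subseteq\underline{V}$; each underlay link $\underline{e}$ has finite capacity $C_{\underline{e}}>0$. Each overlay link $(i,j)$ is implemented by a given routing path $\underline{p}_{i,j}$ in the underlay from $i$ to $j$ (viewed as a set of underlay links), with propagation delay $l_{i,j}\ge 0$. Both graphs are undirected with symmetric paths $\underline{p}_{i,j}=\underline{p}_{j,i}$ and equal capacity in both directions, but in everything related to routing, overlay links $(i,j)$ are treated as directed (both orientations are present), and capacity is counted separately for each direction of each underlay link. That is, each underlay link is replaced by its two directed versions, each of capacity $C_{\underline{e}}$, and $\underline{p}_{j,i}$ is the reversal of $\underline{p}_{i,j}$. **Demands.** $H$ is a finite set of multicast demands $h=(s_h,T_h,\kappa_h)$ with source $s_h\in V$, nonempty destination set $T_h\subseteq V\setminus\{s_h\}$ and data size $\kappa_h>0$. (They arise from a set $E_a\subseteq E$ of activated overlay links: there is one demand for each agent $i$ having at least one neighbor in $(V,E_a)$, with $s_h=i$, with $T_h$ the set of neighbors of $i$ in $(V,E_a)$, and with data size $\kappa_i$.) **Problem (P).** Put $b^{h,k}_i=1$ if $i=s_h$, $-1$ if $i=k$, and $0$ otherwise. Let $M$ be an upper bound on all $d_h$ (large enough not to exclude otherwise feasible rates). (P) is: minimize $\tau$ over $\boldsymbol z,\boldsymbol r,\boldsymbol d,\boldsymbol f$ subject to - $\tau\ge \kappa_h/d_h+\sum_{(i,j)\in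 E} l_{i,j}r^{h,k}_{ij}$ for all $h\in H$, $k\in T_h$; - $\sum_{(i,j)\in E:\,\underline{e}\in\underline{p}_{i,j}}\sum_{h\in H} f^h_{ij}\le C_{\underline{e}}$ for all $\underline{e}\in\underline{E}$; - $\sum_{j\in V} r^{h,k}_{ij}=\sum_{j\in V} r^{h,k}_{ji}+b^{h,k}_i$ for all $h\in H$, $k\in T_h$, $i\in V$; - $r^{h,k}_{ij}\le z^h_{ij}$ for all $h\in H$, $k\in T_h$, $(i,j)\in E$; - $d_h-M(1-z^h_{ij})\le f^h_{ij}\le d_h$ and $f^h_{ij}\le M z^h_{ij}$ for all $h\in H$, $(i,j)\in E$; - $r^{h,k}_{ij},z^h_{ij}\in\{0,1\}$, $d_h\in[0,M]$, $f^h_{ij}\ge 0$. Here $z^h_{ij}$ indicates whether overlay link $(i,j)$ is used by multicast flow $h$, $r^{h,k}_{ij}$ whether it is used by the flow of $h$ from $s_h$ to $k$, $d_h$ is the rate of flow $h$, and $f^h_{ij}$ is the rate of flow $h$ on $(i,j)$ (the constraints force $f^h_{ij}=d_h z^h_{ij}$). **Routing solution.** A binary vector $\boldsymbol z$ for which some binary $\boldsymbol r$ satisfies the third and fourth constraints. **Equal bandwidth sharing.** At each underlay link $\underline{e}$ with $t_{\underline{e}}>0$, each activated unicast flow traversing it is allotted bandwidth $C_{\underline{e}}/t_{\underline{e}}$. The rate of a unicast flow is the minimum of its allotments along its path, and the rate of a multicast flow $h$ is the minimum rate of the activated unicast flows constituting it. *)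

theory Defs
  imports
    "HOL-Library.Extended_Real"
    "Graph_Theory.Graph_Theory"
begin

text \<open>
  The undirected underlay is a \<^locale>\<open>pair_graph\<close>: a finite loop-free digraph with a symmetric
  arc set.  Every undirected underlay link thus contributes its two directed versions, each with
  its own capacity constraint.  The field \<open>route\<close> maps a directed overlay link \<open>(i, j)\<close> to
  the arc list of its underlay path.
\<close>

record 'v network =
  underlay :: "'v pair_pre_digraph"
  agents :: "'v set"
  cap :: "'v \<times> 'v \<Rightarrow> real"
  route :: "'v \<times> 'v \<Rightarrow> ('v \<times> 'v) list"
  delay :: "'v \<times> 'v \<Rightarrow> real"

record 'v demand =
  src :: 'v
  dests :: "'v set"
  dsize :: real

abbreviation underlay_links :: "'v network \<Rightarrow> ('v \<times> 'v) set" where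
  "underlay_links N \<equiv> parcs (underlay N)"

definition overlay_links :: "'v network \<Rightarrow> ('v \<times> 'v) set" where
  "overlay_links N = {(i, j). i \<in> agents N \<and> j \<in> agents N \<and> i \<noteq> j}"

definition valid_network :: "'v network \<Rightarrow> bool" where
  "valid_network N \<longleftrightarrow>
     pair_graph (underlay N) \<and>
     Digraph_Component.connected (with_proj (underlay N)) \<and>
     agents N \<subseteq> pverts (underlay N) \<and>
     (\<forall>(u, v) \<in> underlay_links N. cap N (u, v) > 0 \<and> cap N (v, u) = cap N (u, v)) \<and>
     (\<forall>(i, j) \<in> overlay_links N.
        pre_digraph.apath (with_proj (underlay N)) i (route N (i, j)) j \<and>
        route N (j, i) = rev (map prod.swap (route N (i, j))) \<and>
        delay N (i, j) \<ge> 0)"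

definition valid_demands :: "'v network \<Rightarrow> 'v demand set \<Rightarrow> bool" where
  "valid_demands N H \<longleftrightarrow>
     finite H \<and>
     (\<forall>h \<in> H. src h \<in> agents N \<and> dests h \<noteq> {} \<and> dests h \<subseteq> agents N - {src h} \<and> dsize h > 0)"

text \<open>
  Variables are total functions; only their values at \<open>h \<in> H\<close>, \<open>k \<in> dests h\<close> and overlay links
  matter: \<open>z h (i, j)\<close>, \<open>r h k (i, j)\<close>, \<open>d h\<close>, \<open>f h (i, j)\<close>.
\<close>

definition balance :: "'v demand \<Rightarrow> 'v \<Rightarrow> 'v \<Rightarrow> real" where
  "balance h k i = (if i = src h then 1 else if i = k then - 1 else 0)"

definition binary_routing :: "'v network \<Rightarrow> 'v demand set \<Rightarrow> ('v demand \<Rightarrow> 'v \<times> 'v \<Rightarrow> real) \<Rightarrow> bool" where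
  "binary_routing N H z \<longleftrightarrow> (\<forall>h \<in> H. \<forall>e \<in> overlay_links N. z h e \<in> {0, 1})"

definition routes ::
  "'v network \<Rightarrow> 'v demand set \<Rightarrow> ('v demand \<Rightarrow> 'v \<times> 'v \<Rightarrow> real) \<Rightarrow>
   ('v demand \<Rightarrow> 'v \<Rightarrow> 'v \<times> 'v \<Rightarrow> real) \<Rightarrow> bool" where
  "routes N H z r \<longleftrightarrow>
     (\<forall>h \<in> H. \<forall>k \<in> dests h.
        (\<forall>e \<in> overlay_links N. r h k e \<in> {0, 1}) \<and>
        (\<forall>i \<in> agents N.
           (\<Sum>j | (i, j) \<in> overlay_links N. r h k (i, j)) =
           (\<Sum>j | (j, i) \<in> overlay_links N. r h k (j, i)) + balance h k i) \<and>
        (\<forall>e \<in> overlay_links N. r h k e \<le> z h e))"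

definition routing_solution ::
  "'v network \<Rightarrow> 'v demand set \<Rightarrow> ('v demand \<Rightarrow> 'v \<times> 'v \<Rightarrow> real) \<Rightarrow> bool" where
  "routing_solution N H z \<longleftrightarrow> binary_routing N H z \<and> (\<exists>r. routes N H z r)"

definition within_capacity ::
  "'v network \<Rightarrow> 'v demand set \<Rightarrow> ('v demand \<Rightarrow> 'v \<times> 'v \<Rightarrow> real) \<Rightarrow> bool" where
  "within_capacity N H f \<longleftrightarrow>
     (\<forall>a \<in> underlay_links N.
        (\<Sum>e | e \<in> overlay_links N \<and> a \<in> set (route N e). \<Sum>h \<in> H. f h e) \<le> cap N a)"

text \<open>
  The delay constraint is stated over \<^typ>\<open>ereal\<close>, where \<open>dsize h / 0 = \<infinity>\<close>; over the reals
  \<open>x / 0 = 0\<close> would make a zero rate optimal.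
\<close>

definition feasible ::
  "'v network \<Rightarrow> 'v demand set \<Rightarrow> real \<Rightarrow> real \<Rightarrow> ('v demand \<Rightarrow> 'v \<times> 'v \<Rightarrow> real) \<Rightarrow>
   ('v demand \<Rightarrow> 'v \<Rightarrow> 'v \<times> 'v \<Rightarrow> real) \<Rightarrow> ('v demand \<Rightarrow> real) \<Rightarrow>
   ('v demand \<Rightarrow> 'v \<times> 'v \<Rightarrow> real) \<Rightarrow> bool" where
  "feasible N H M \<tau> z r d f \<longleftrightarrow>
     (\<forall>h \<in> H. \<forall>k \<in> dests h.
        ereal (dsize h) / ereal (d h) + ereal (\<Sum>e \<in> overlay_links N. delay N e * r h k e) \<le> ereal \<tau>) \<and>
     within_capacity N H f \<and>
     routes N H z r \<and>
     binary_routing N H z \<and>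
     (\<forall>h \<in> H. 0 \<le> d h \<and> d h \<le> M) \<and>
     (\<forall>h \<in> H. \<forall>e \<in> overlay_links N.
        d h - M * (1 - z h e) \<le> f h e \<and> f h e \<le> d h \<and> f h e \<le> M * z h e \<and> 0 \<le> f h e)"

text \<open>
  \<open>M\<close> cuts off no rates that some routing solution could carry: without the big-\<open>M\<close>
  linearization the flow rates are \<open>d h * z h e\<close>.
\<close>

definition valid_bigM :: "'v network \<Rightarrow> 'v demand set \<Rightarrow> real \<Rightarrow> bool" where
  "valid_bigM N H M \<longleftrightarrow>
     (\<forall>z d. routing_solution N H z \<and> (\<forall>h \<in> H. 0 \<le> d h) \<and>
            within_capacity N H (\<lambda>h e. d h * z h e) \<longrightarrow>
            (\<forall>h \<in> H. d h \<le> M))"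

definition optimal_value ::
  "'v network \<Rightarrow> 'v demand set \<Rightarrow> real \<Rightarrow> ('v demand \<Rightarrow> 'v \<times> 'v \<Rightarrow> real) \<Rightarrow> real \<Rightarrow> bool" where
  "optimal_value N H M z v \<longleftrightarrow>
     (\<exists>r d f. feasible N H M v z r d f) \<and>
     (\<forall>\<tau> r d f. feasible N H M \<tau> z r d f \<longrightarrow> v \<le> \<tau>)"

definition num_flows ::
  "'v network \<Rightarrow> 'v demand set \<Rightarrow> ('v demand \<Rightarrow> 'v \<times> 'v \<Rightarrow> real) \<Rightarrow> 'v \<times> 'v \<Rightarrow> real" where
  "num_flows N H z a =
     (\<Sum>e | e \<in> overlay_links N \<and> a \<in> set (route N e). \<Sum>h \<in> H. z h e)"

definition unicast_rate ::
  "'v network \<Rightarrow> 'v demand set \<Rightarrow> ('v demand \<Rightarrow> 'v \<times> 'v \<Rightarrow> real) \<Rightarrow> 'v \<times> 'v \<Rightarrow> real" where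
  "unicast_rate N H z e = Min ((\<lambda>a. cap N a / num_flows N H z a) ` set (route N e))"

definition equal_share_rate ::
  "'v network \<Rightarrow> 'v demand set \<Rightarrow> ('v demand \<Rightarrow> 'v \<times> 'v \<Rightarrow> real) \<Rightarrow> 'v demand \<Rightarrow> real" where
  "equal_share_rate N H z h = Min (unicast_rate N H z ` {e \<in> overlay_links N. z h e = 1})"

end

theory Submission
  imports Defs
begin

text \<open>
  Under equal delays and sizes only the slowest rate matters.  If every rate is at least
  \<open>\<kappa> / \<tau>\<close>, a link carrying \<open>t\<close> flows carries traffic at least \<open>\<kappa> t / \<tau>\<close>, so
  \<open>\<tau> \<ge> \<kappa> t / C\<close>.  Conversely, an equal share is some ratio \<open>C / t\<close> on an underlay link and at
  most the ratio \<open>C / t\<close> of each link it crosses, which gives the delay bound and the capacity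
  constraints respectively.
\<close>

section \<open>Finiteness, capacities and routes of a valid network\<close>

lemma finite_underlay_links:
  assumes "valid_network N"
  shows "finite (underlay_links N)"
  using assms pair_fin_digraph.pair_finite_arcs
  unfolding valid_network_def pair_graph_def pair_digraph_def by blast

lemma finite_overlay_links:
  assumes "valid_network N"
  shows "finite (overlay_links N)"
proof -
  have "finite (pverts (underlay N))"
    using assms pair_fin_digraph.pair_finite_verts
    unfolding valid_network_def pair_graph_def pair_digraph_def by blast
  then have "finite (agents N)"
    using assms finite_subset unfolding valid_network_def by blast
  moreover have "overlay_links N \<subseteq> agents N \<times> agents N"
    by (auto simp: overlay_links_def)
  ultimately show ?thesis
    using finite_subset by blast
qed

lemma cap_pos:
  assumes "valid_network N" and "a \<in> underlay_links N"
  shows "cap N a > 0"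
  using assms by (cases a) (auto simp: valid_network_def)

lemma route_subset_underlay_links:
  assumes "valid_network N" and "e \<in> overlay_links N"
  shows "set (route N e) \<subseteq> underlay_links N"
  using assms
  by (cases e) (auto simp: valid_network_def pre_digraph.apath_def pre_digraph.awalk_def)

text \<open>A walk without arcs has equal endpoints, while an overlay link joins distinct agents.
  This keeps the \<open>Min\<close> in \<open>unicast_rate\<close> over a nonempty set.\<close>

lemma route_not_Nil:
  assumes "valid_network N" and "e \<in> overlay_links N"
  shows "route N e \<noteq> []"
proof -
  obtain i j where e: "e = (i, j)" and "i \<noteq> j"
    using assms(2) by (auto simp: overlay_links_def)
  moreover have "pre_digraph.cas (with_proj (underlay N)) i (route N (i, j)) j"
    using assms unfolding e
    by (auto simp: valid_network_def pre_digraph.apath_def pre_digraph.awalk_def)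
  ultimately show ?thesis
    by (auto simp: pre_digraph.cas.simps)
qed

section \<open>Binary routings and the flow counts they induce\<close>

lemma binary_routing_cases:
  assumes "binary_routing N H z" and "h \<in> H" and "e \<in> overlay_links N"
  obtains "z h e = 0" | "z h e = 1"
  using assms unfolding binary_routing_def by auto

lemma binary_routing_nonneg:
  assumes "binary_routing N H z" and "h \<in> H" and "e \<in> overlay_links N"
  shows "z h e \<ge> 0"
  using assms by (auto elim: binary_routing_cases)

text \<open>At the source, flow conservation forces an outgoing link of value 1.\<close>

lemma routing_solution_activates_link:
  assumes "valid_demands N H" and "routing_solution N H z" and h: "h \<in> H"
  obtains e where "e \<in> overlay_links N" "z h e = 1"
proof -
  obtain r where r: "routes N H z r" and z: "binary_routing N H z"
    using assms(2) unfolding routing_solution_def by blast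
  obtain k where k: "k \<in> dests h"
    using assms(1) h unfolding valid_demands_def by blast
  let ?s = "src h"
  have bin: "r h k e \<in> {0, 1}" "r h k e \<le> z h e" if "e \<in> overlay_links N" for e
    using r h k that unfolding routes_def by blast+
  have "?s \<in> agents N"
    using assms(1) h unfolding valid_demands_def by blast
  then have "(\<Sum>j | (?s, j) \<in> overlay_links N. r h k (?s, j)) =
      (\<Sum>j | (j, ?s) \<in> overlay_links N. r h k (j, ?s)) + 1"
    using r h k unfolding routes_def balance_def by fastforce
  moreover have "(\<Sum>j | (j, ?s) \<in> overlay_links N. r h k (j, ?s)) \<ge> 0"
    using bin(1) by (intro sum_nonneg) fastforce
  ultimately have "(\<Sum>j | (?s, j) \<in> overlay_links N. r h k (?s, j)) \<noteq> 0"
    by linarith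
  then obtain j where j: "(?s, j) \<in> overlay_links N" "r h k (?s, j) \<noteq> 0"
    by (metis (no_types, lifting) mem_Collect_eq sum.neutral)
  then have "z h (?s, j) \<ge> 1"
    using bin[OF j(1)] by auto
  then have "z h (?s, j) = 1"
    using binary_routing_cases[OF z h j(1)] by fastforce
  then show thesis
    using that j(1) by blast
qed

lemma num_flows_nonneg:
  assumes "binary_routing N H z"
  shows "num_flows N H z a \<ge> 0"
  unfolding num_flows_def
  using binary_routing_nonneg[OF assms] by (auto intro!: sum_nonneg)

text \<open>The left side is one term of a double sum of nonnegative terms. With
  \<open>z h e = 1\<close> it shows that the count is at least 1 on every arc of an activated
  route.\<close>

lemma num_flows_ge:
  assumes "valid_network N" and "finite H" and z: "binary_routing N H z"
    and "h \<in> H" and "e \<in> overlay_links N" and "a \<in> set (route N e)"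
  shows "z h e \<le> num_flows N H z a"
proof -
  have "z h e \<le> (\<Sum>h \<in> H. z h e)"
    using assms binary_routing_nonneg[OF z] by (intro member_le_sum) auto
  also have "\<dots> \<le> num_flows N H z a"
    unfolding num_flows_def
    using assms binary_routing_nonneg[OF z] finite_overlay_links[of N]
    by (intro member_le_sum[of e _ "\<lambda>e. \<Sum>h \<in> H. z h e"]) (auto intro!: sum_nonneg)
  finally show ?thesis .
qed

section \<open>Rates under equal sharing\<close>

lemma equal_share_rate_le:
  assumes "valid_network N" and "h \<in> H" and "e \<in> overlay_links N" and "z h e = 1"
    and "a \<in> set (route N e)"
  shows "equal_share_rate N H z h \<le> cap N a / num_flows N H z a"
proof -
  have "equal_share_rate N H z h \<le> unicast_rate N H z e"
    unfolding equal_share_rate_def using assms finite_overlay_links[of N] by (intro Min_le) auto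
  also have "\<dots> \<le> cap N a / num_flows N H z a"
    unfolding unicast_rate_def using assms by (intro Min_le) auto
  finally show ?thesis .
qed

text \<open>Both nested minima range over finite nonempty sets, so some arc of some activated route
  attains them. That route's own flow is counted on the arc, so the quotient is genuine and not the
  default value of a division by 0.\<close>

lemma equal_share_rate_attained:
  assumes N: "valid_network N" and H: "valid_demands N H" and z: "routing_solution N H z"
    and h: "h \<in> H"
  obtains a where "a \<in> underlay_links N" "num_flows N H z a > 0"
    "equal_share_rate N H z h = cap N a / num_flows N H z a"
proof -
  let ?A = "{e \<in> overlay_links N. z h e = 1}"
  have "?A \<noteq> {}"
    using routing_solution_activates_link[OF H z h] by blast
  then have "equal_share_rate N H z h \<in> unicast_rate N H z ` ?A"
    unfolding equal_share_rate_def using finite_overlay_links[OF N] by (intro Min_in) auto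
  then obtain e where e: "e \<in> overlay_links N" "z h e = 1"
    and d: "equal_share_rate N H z h = unicast_rate N H z e" by auto
  have "unicast_rate N H z e \<in> (\<lambda>a. cap N a / num_flows N H z a) ` set (route N e)"
    unfolding unicast_rate_def using route_not_Nil[OF N e(1)] by (intro Min_in) auto
  then obtain a where a: "a \<in> set (route N e)"
    and u: "unicast_rate N H z e = cap N a / num_flows N H z a" by auto
  have "1 \<le> num_flows N H z a"
    using num_flows_ge[of N H z h e a] N H z h e a
    by (auto simp: valid_demands_def routing_solution_def)
  then show thesis
    using that[of a] route_subset_underlay_links[OF N e(1)] a d u by auto
qed

lemma equal_share_rate_pos:
  assumes "valid_network N" and "valid_demands N H" and "routing_solution N H z" and "h \<in> H"
  shows "equal_share_rate N H z h > 0"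
  using equal_share_rate_attained[OF assms] cap_pos[OF assms(1)] by (metis divide_pos_pos)

lemma within_capacity_equal_share:
  assumes N: "valid_network N" and H: "valid_demands N H" and z: "routing_solution N H z"
  shows "within_capacity N H (\<lambda>h e. equal_share_rate N H z h * z h e)"
  unfolding within_capacity_def
proof
  fix a assume a: "a \<in> underlay_links N"
  let ?E = "{e \<in> overlay_links N. a \<in> set (route N e)}" and ?t = "num_flows N H z a"
  have bin: "binary_routing N H z"
    using z unfolding routing_solution_def by blast
  have "(\<Sum>e\<in>?E. \<Sum>h\<in>H. equal_share_rate N H z h * z h e) \<le> (\<Sum>e\<in>?E. \<Sum>h\<in>H. cap N a / ?t * z h e)"
  proof (intro sum_mono)
    fix e h assume "e \<in> ?E" and h: "h \<in> H"
    then have e: "e \<in> overlay_links N" "a \<in> set (route N e)" by auto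
    \<comment> \<open>An inactive link gives 0 on both sides; an active one crosses
      \<open>a\<close>, so its rate is at most the share at \<open>a\<close>.\<close>
    show "equal_share_rate N H z h * z h e \<le> cap N a / ?t * z h e"
      using binary_routing_cases[OF bin h e(1)] equal_share_rate_le[where z=z, OF N h e(1) _ e(2)]
      by fastforce
  qed
  also have "\<dots> = cap N a / ?t * ?t"
    unfolding num_flows_def by (simp only: sum_distrib_left)
  \<comment> \<open>If \<open>?t = 0\<close>, the product is 0 and the capacity is positive;
    otherwise \<open>?t\<close> cancels.\<close>
  also have "\<dots> \<le> cap N a"
    using cap_pos[OF N a] by (cases "?t = 0") auto
  finally show "(\<Sum>e\<in>?E. \<Sum>h\<in>H. equal_share_rate N H z h * z h e) \<le> cap N a" .
qed

section \<open>The two bounds on the optimal value\<close>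

lemma equal_share_feasible:
  assumes N: "valid_network N" and H: "valid_demands N H" and M: "valid_bigM N H M"
    and z: "routing_solution N H z" and r: "routes N H z r"
    and l: "\<forall>e \<in> overlay_links N. delay N e = 0"
    and \<kappa>: "\<forall>h \<in> H. dsize h = \<kappa>"
  shows "feasible N H M (Max ((\<lambda>a. \<kappa> * num_flows N H z a / cap N a) ` underlay_links N)) z r
    (equal_share_rate N H z) (\<lambda>h e. equal_share_rate N H z h * z h e)"
proof -
  let ?d = "equal_share_rate N H z"
  let ?T = "(\<lambda>a. \<kappa> * num_flows N H z a / cap N a) ` underlay_links N"
  have bin: "binary_routing N H z"
    using z unfolding routing_solution_def by blast
  have pos: "?d h > 0" if "h \<in> H" for h
    using equal_share_rate_pos[OF N H z that] .
  have cap: "within_capacity N H (\<lambda>h e. ?d h * z h e)"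
    using within_capacity_equal_share[OF N H z] .
  \<comment> \<open>The equal shares are themselves rates that \<open>z\<close> can carry within
    capacity, and \<open>valid_bigM\<close> bounds all such rates.\<close>
  then have le_M: "?d h \<le> M" if "h \<in> H" for h
    using M z pos that unfolding valid_bigM_def by (meson less_imp_le)
  have "\<kappa> / ?d h \<le> Max ?T" if h: "h \<in> H" for h
  proof -
    obtain a where a: "a \<in> underlay_links N" "?d h = cap N a / num_flows N H z a"
      using equal_share_rate_attained[OF N H z h] by blast
    then show ?thesis
      using finite_underlay_links[OF N] by (auto intro!: Max_ge)
  qed
  \<comment> \<open>Since the rate is positive, the \<open>ereal\<close> quotient is the real one;
    the delay sum vanishes for any \<open>r\<close>.\<close>
  then have delay: "ereal (dsize h) / ereal (?d h)
      + ereal (\<Sum>e \<in> overlay_links N. delay N e * r h k e) \<le> ereal (Max ?T)" if "h \<in> H" for h k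
    using that pos[OF that] \<kappa> l by (simp add: less_imp_neq)
  have "?d h - M * (1 - z h e) \<le> ?d h * z h e \<and> ?d h * z h e \<le> ?d h \<and>
      ?d h * z h e \<le> M * z h e \<and> 0 \<le> ?d h * z h e" if "h \<in> H" "e \<in> overlay_links N" for h e
    using binary_routing_cases[OF bin that] pos[OF that(1)] le_M[OF that(1)] by fastforce
  then show ?thesis
    unfolding feasible_def using delay cap r bin pos le_M by (simp add: less_imp_le)
qed

text \<open>Scaling the capacity constraint at \<open>a\<close> by \<open>\<tau>\<close> lets each
  term \<open>\<tau> * f h e\<close> be compared with \<open>\<kappa> * z h e\<close>, and the
  latter sum to \<open>\<kappa>\<close> times the flow count.\<close>

lemma feasible_ge:
  assumes N: "valid_network N" and H: "valid_demands N H" and ne: "H \<noteq> {}"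
    and l: "\<forall>e \<in> overlay_links N. delay N e = 0"
    and \<kappa>: "\<forall>h \<in> H. dsize h = \<kappa>"
    and feas: "feasible N H M \<tau> z r d f" and a: "a \<in> underlay_links N"
  shows "\<kappa> * num_flows N H z a / cap N a \<le> \<tau>"
proof -
  let ?E = "{e \<in> overlay_links N. a \<in> set (route N e)}"
  have bin: "binary_routing N H z"
    using feas unfolding feasible_def by blast
  have \<kappa>_pos: "\<kappa> > 0"
    using H ne \<kappa> unfolding valid_demands_def by auto
  have d: "\<kappa> \<le> \<tau> * d h \<and> d h > 0" if h: "h \<in> H" for h
  proof -
    obtain k where "k \<in> dests h"
      using H h unfolding valid_demands_def by blast
    then have "ereal (dsize h) / ereal (d h)
        + ereal (\<Sum>e \<in> overlay_links N. delay N e * r h k e) \<le> ereal \<tau>"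
      using feas h unfolding feasible_def by blast
    moreover have "(\<Sum>e \<in> overlay_links N. delay N e * r h k e) = 0"
      using l by simp
    ultimately have *: "ereal \<kappa> / ereal (d h) \<le> ereal \<tau>"
      using \<kappa> h by (simp add: zero_ereal_def[symmetric])
    \<comment> \<open>In \<open>ereal\<close> a positive size over rate 0 is infinite, which no real
      \<open>\<tau>\<close> bounds.\<close>
    have "d h \<noteq> 0"
    proof
      assume "d h = 0"
      with * \<kappa>_pos show False by (simp add: divide_ereal_def zero_ereal_def[symmetric])
    qed
    moreover have "d h \<ge> 0"
      using feas h unfolding feasible_def by blast
    ultimately have "d h > 0" by simp
    then show ?thesis
      using * by (simp add: divide_le_eq)
  qed
  \<comment> \<open>The sign is what allows multiplying the bounds on \<open>f\<close> and the
    capacity constraint by \<open>\<tau>\<close>; it comes from any one demand.\<close>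
  have \<tau>_pos: "\<tau> > 0"
  proof -
    obtain h where "h \<in> H" using ne by blast
    then have "0 < \<tau> * d h" "0 < d h" using d \<kappa>_pos by fastforce+
    then show ?thesis by (simp add: zero_less_mult_iff)
  qed
  have "\<kappa> * num_flows N H z a = (\<Sum>e\<in>?E. \<Sum>h\<in>H. \<kappa> * z h e)"
    unfolding num_flows_def by (simp only: sum_distrib_left)
  also have "\<dots> \<le> (\<Sum>e\<in>?E. \<Sum>h\<in>H. \<tau> * f h e)"
  proof (intro sum_mono)
    fix e h assume "e \<in> ?E" and h: "h \<in> H"
    then have e: "e \<in> overlay_links N" by simp
    \<comment> \<open>The first bound becomes \<open>d h \<le> f h e\<close> when
      \<open>z h e = 1\<close>; the second settles \<open>z h e = 0\<close>.\<close>
    have f: "d h - M * (1 - z h e) \<le> f h e" "0 \<le> f h e"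
      using feas h e unfolding feasible_def by blast+
    from bin h e show "\<kappa> * z h e \<le> \<tau> * f h e"
    proof (cases rule: binary_routing_cases)
      case 1
      then show ?thesis using f \<tau>_pos by simp
    next
      case 2
      then have "\<tau> * d h \<le> \<tau> * f h e"
        using f \<tau>_pos by simp
      then show ?thesis using d[OF h] 2 by simp
    qed
  qed
  also have "\<dots> = \<tau> * (\<Sum>e\<in>?E. \<Sum>h\<in>H. f h e)"
    by (simp only: sum_distrib_left)
  also have "\<dots> \<le> \<tau> * cap N a"
    using feas a \<tau>_pos unfolding feasible_def within_capacity_def by simp
  finally show ?thesis
    using cap_pos[OF N a] by (simp add: divide_le_eq)
qed

theorem mainTheorem1:
  fixes N :: "'v network" and H :: "'v demand set" and M \<kappa> :: real
    and z :: "'v demand \<Rightarrow> 'v \<times> 'v \<Rightarrow> real"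
  assumes "valid_network N"
    and "valid_demands N H" and "H \<noteq> {}"
    and "valid_bigM N H M"
    and "routing_solution N H z"
    and "\<forall>e \<in> overlay_links N. delay N e = 0"
    and "\<forall>h \<in> H. dsize h = \<kappa>"
  defines "\<tau>opt \<equiv> Max ((\<lambda>a. \<kappa> * num_flows N H z a / cap N a) ` underlay_links N)"
    and "d \<equiv> equal_share_rate N H z"
  shows "optimal_value N H M z \<tau>opt \<and>
         (\<forall>r. routes N H z r \<longrightarrow> feasible N H M \<tau>opt z r d (\<lambda>h e. d h * z h e))"
proof -
  have feas: "feasible N H M \<tau>opt z r d (\<lambda>h e. d h * z h e)" if "routes N H z r" for r
    unfolding \<tau>opt_def d_def
    using equal_share_feasible[OF assms(1,2,4,5) that assms(6,7)] .
  \<comment> \<open>A demand's rate is attained at some arc, so \<open>Max\<close> is taken over a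
    nonempty set and is bounded by \<open>\<tau>\<close> once all its members are.\<close>
  have "underlay_links N \<noteq> {}"
    using equal_share_rate_attained[OF assms(1,2,5)] assms(3) by blast
  then have "\<tau>opt \<le> \<tau>" if "feasible N H M \<tau> z r d f" for \<tau> r d f
    unfolding \<tau>opt_def
    using feasible_ge[OF assms(1,2,3,6,7) that] finite_underlay_links[OF assms(1)] by simp
  then show ?thesis
    using feas assms(5) unfolding optimal_value_def routing_solution_def by blast
qed

end
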